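(* Let $\mathbb{R}^n$ be endowed with the Euclidean norm $\|\cdot\|$, let $p\ge 2$, let $a_1,\dots,a_m\in\mathbb{R}^n$, and let $\overline b\in\mathbb{R}^m$ be such that the linear system $\sigma(\overline b)=\{\langle a_i,x\rangle\le\overline b_i,\ i=1,\dots,m\}$ is inconsistent and for each $i=1,\dots,m$ there exists $\widehat x_i\in\mathbb{R}^n$ with $\langle a_i,\widehat x_i\rangle<\overline b_i$. Let $S_i:=\{x\in\mathbb{R}^n:\langle a_i,x\rangle\le\overline b_i\}$, $$\mathcal{A}:=\arg\min_{x\in\mathbb{R}^n}\sum_{i=1}^m\|a_i\|^p d_{S_i}^p(x),$$ and let $\overline d=(d_i^+)_{i=1,\dots,m}\in\mathbb{R}^m$, where $d_i^+$ is the constant value of $\|a_i\|\,d_{S_i}(\cdot)$ on $\mathcal{A}$. Then $$d_p(\overline b,\Theta_c)=\|\overline d\|_p,$$ where $d_i^+=\|a_i\|\,d_{S_i}(x)=[\langle a_i,x\rangle-\overline b_i]_+$ for all $x\in\mathcal{A}$ and $i=1,\dots,m$. Moreover, $\sigma(\overline b+\overline d)$ is a consistent system nearest to $\sigma(\overline b)$, i.e., $\overline b+\overline d\in\Theta_c$ and $\|\overline d\|_p=d_p(\overline b,\Theta_c)$.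
   Context: For $b\in\mathbb{R}^m$, $\sigma(b)$ is the system $\{\langle a_i,x\rangle\le b_i,\ i=1,\dots,m\}$ in the unknown $x\in\mathbb{R}^n$, consistent if it has a solution; $\Theta_c$ is the set of $b\in\mathbb{R}^m$ with $\sigma(b)$ consistent. $p$ is a (finite) real number, $\|\cdot\|_p$ is the $p$-norm on $\mathbb{R}^m$ and $d_p(\overline b,\Theta_c)=\inf\{\|\overline b-b\|_p:b\in\Theta_c\}$. $d_{S_i}$ is the Euclidean distance function to $S_i$; $[t]_+=\max\{t,0\}$. The set $\mathcal{A}$ is nonempty and each function $\|a_i\|d_{S_i}$ is constant on $\mathcal{A}$, so $\overline d$ is well defined. *)

theory Defs
  imports "HOL-Analysis.Analysis"
begin

definition consistent :: "('m::finite \<Rightarrow> real^'n) \<Rightarrow> real^'m \<Rightarrow> bool" where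
  "consistent a b \<longleftrightarrow> (\<exists>x. \<forall>i. a i \<bullet> x \<le> b $ i)"

definition consistent_rhs :: "('m::finite \<Rightarrow> real^'n) \<Rightarrow> (real^'m) set" where
  "consistent_rhs a = {b. consistent a b}"

definition pnorm :: "real \<Rightarrow> real^'m::finite \<Rightarrow> real" where
  "pnorm p v = (\<Sum>i\<in>UNIV. \<bar>v $ i\<bar> powr p) powr (1 / p)"

definition pdist_set :: "real \<Rightarrow> real^'m::finite \<Rightarrow> (real^'m) set \<Rightarrow> real" where
  "pdist_set p b T = (INF b'\<in>T. pnorm p (b - b'))"

definition halfspace :: "('m::finite \<Rightarrow> real^'n) \<Rightarrow> real^'m \<Rightarrow> 'm \<Rightarrow> (real^'n) set" where
  "halfspace a b i = {x. a i \<bullet> x \<le> b $ i}"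

definition minimizers :: "real \<Rightarrow> ('m::finite \<Rightarrow> real^'n) \<Rightarrow> real^'m \<Rightarrow> (real^'n) set" where
  "minimizers p a b =
     {x. is_arg_min (\<lambda>y. \<Sum>i\<in>UNIV. norm (a i) powr p * infdist y (halfspace a b i) powr p)
           (\<lambda>_. True) x}"

(* The i-th entry is the constant value on the set of minimizers. It is a meaningful value only if
   that set is nonempty and the function is constant on it; otherwise THE is unspecified. *)
definition residual :: "real \<Rightarrow> ('m::finite \<Rightarrow> real^'n) \<Rightarrow> real^'m \<Rightarrow> real^'m" where
  "residual p a b =
     (\<chi> i. THE t. (\<lambda>x. norm (a i) * infdist x (halfspace a b i)) ` minimizers p a b = {t})"

end

theory Submission
  imports Defs
begin

text \<open>Moving \<open>b\<close> as little as possible in the \<open>p\<close>-norm into the set of consistent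
right-hand sides amounts to minimizing the objective
\<open>F x = (\<Sum>i\<in>UNIV. norm (a i) powr p * infdist x (halfspace a b i) powr p)\<close>.
By the formula for the distance to a halfspace, \<open>F x\<close> is the \<open>p\<close>-th power
of the \<open>p\<close>-norm of the excess vector with entries \<open>max (a i \<bullet> x - b $ i) 0\<close>. Adding this vector
to \<open>b\<close> makes \<open>x\<close> a solution, and every right-hand side that has \<open>x\<close> as a solution differs
from \<open>b\<close> by at least the excess in each coordinate. So the excess is the cheapest correction that
makes the given \<open>x\<close> feasible, and the distance from \<open>b\<close> to the consistent right-hand sides
is the infimum of the \<open>p\<close>-norm of the excess over all \<open>x\<close>
(\<open>pnorm_excess_le\<close>, \<open>add_excess_consistent\<close>).

Two points remain. The infimum is attained, although the excess need not be
coercive in \<open>x\<close>: the consistent right-hand sides form a finitely generated cone, which is closed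
(\<open>closed_consistent_rhs\<close>), so \<open>b\<close> has a nearest point in it, and any solution of the system
with that right-hand side is a minimizer. The excess is the same at all minimizers: the excess at
a midpoint is at most the mean of the excesses, and \<open>t powr p\<close> is strictly convex for
\<open>p > 1\<close>, so two minimizers with different excesses would be beaten by their midpoint
(\<open>minimal_excess_unique\<close>).\<close>

section \<open>Strict convexity of real powers\<close>

text \<open>The mean value theorem on the two halves of the interval, with the derivative
\<open>p * x powr (p - 1)\<close> strictly increasing. The theorem needs no derivative at the end points,
which lets the interval start at \<open>0\<close>.\<close>

lemma powr_midpoint_strict_aux:
  fixes u v p :: real
  assumes p: "p > 1" and u: "0 \<le> u" and uv: "u < v"
  shows "((u + v) / 2) powr p < (u powr p + v powr p) / 2"
proof -
  define m where "m = (u + v) / 2"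
  have um: "u < m" "m < v" using uv by (auto simp: m_def)
  have cont: "continuous_on {s..t} (\<lambda>x. x powr p)" if "0 \<le> s" for s t :: real
    using that p by (intro continuous_on_powr' continuous_intros) auto
  have der: "((\<lambda>x. x powr p) has_real_derivative p * x powr (p - 1)) (at x)" if "0 < x" for x
    using that by (rule has_real_derivative_powr)
  have mvt: "\<exists>z. s < z \<and> z < t \<and> t powr p - s powr p = (t - s) * (p * z powr (p - 1))"
    if st: "0 \<le> s" "s < t" for s t :: real
  proof -
    obtain l z where z: "s < z" "z < t" "DERIV (\<lambda>x. x powr p) z :> l"
        "t powr p - s powr p = (t - s) * l"
      using MVT[OF st(2) cont[OF st(1)]] der st(1)
      by (meson le_less_trans real_differentiable_def)
    then have "l = p * z powr (p - 1)"
      using der[of z] st(1) DERIV_unique by force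
    with z show ?thesis by blast
  qed
  obtain y where y: "y < m" "m powr p - u powr p = (m - u) * (p * y powr (p - 1))" "u < y"
    using mvt[OF u um(1)] by blast
  obtain z where z: "m < z" "v powr p - m powr p = (v - m) * (p * z powr (p - 1))"
    using mvt[of m v] u um by auto
  have "y powr (p - 1) < z powr (p - 1)"
    using y z u p by (intro powr_less_mono2) auto
  then have "(m - u) * (p * y powr (p - 1)) < (m - u) * (p * z powr (p - 1))"
    using um p by simp
  also have "m - u = v - m" by (simp add: m_def field_simps)
  finally have "m powr p - u powr p < v powr p - m powr p"
    using y z by (simp add: \<open>m - u = v - m\<close>)
  then show ?thesis by (simp add: m_def)
qed

lemma powr_midpoint_strict:
  fixes u v p :: real
  assumes "p > 1" "0 \<le> u" "0 \<le> v" "u \<noteq> v"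
  shows "((u + v) / 2) powr p < (u powr p + v powr p) / 2"
  using powr_midpoint_strict_aux[of p u v] powr_midpoint_strict_aux[of p v u] assms
  by (cases "u < v") (auto simp: add.commute)

section \<open>The distance to a halfspace\<close>

text \<open>Cauchy-Schwarz gives the lower bound; the orthogonal projection onto the bounding hyperplane
attains it. For \<open>a = 0\<close> the halfspace, being nonempty, is the whole space and both
sides vanish.\<close>

lemma norm_mult_infdist_halfspace:
  fixes a x :: "'a::real_inner"
  assumes ne: "a \<bullet> z \<le> \<beta>"
  shows "norm a * infdist x {y. a \<bullet> y \<le> \<beta>} = max (a \<bullet> x - \<beta>) 0"
proof (cases "a \<bullet> x \<le> \<beta>")
  case True
  then show ?thesis by simp
next
  case False
  let ?H = "{y. a \<bullet> y \<le> \<beta>}"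
  have a0: "a \<noteq> 0" using ne False by auto
  define t where "t = (a \<bullet> x - \<beta>) / (norm a)\<^sup>2"
  have t: "0 \<le> t" using False by (simp add: t_def)
  have "a \<bullet> (x - t *\<^sub>R a) = \<beta>"
    using a0 by (simp add: t_def inner_diff_right power2_norm_eq_inner)
  then have "infdist x ?H \<le> dist x (x - t *\<^sub>R a)"
    by (intro infdist_le) simp
  also have "\<dots> = t * norm a" using t by (simp add: dist_norm)
  finally have "norm a * infdist x ?H \<le> norm a * (t * norm a)"
    by (simp add: mult_left_mono)
  also have "\<dots> = a \<bullet> x - \<beta>"
    using a0 by (simp add: t_def power2_eq_square)
  finally have upper: "norm a * infdist x ?H \<le> a \<bullet> x - \<beta>" .
  have "(a \<bullet> x - \<beta>) / norm a \<le> dist x y" if "y \<in> ?H" for y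
  proof -
    have "a \<bullet> x - \<beta> \<le> a \<bullet> (x - y)" using that by (simp add: inner_diff_right)
    also have "\<dots> \<le> norm a * dist x y" by (simp add: dist_norm norm_cauchy_schwarz)
    finally show ?thesis using a0 by (simp add: field_simps)
  qed
  moreover have "?H \<noteq> {}" using ne by blast
  ultimately have "(a \<bullet> x - \<beta>) / norm a \<le> infdist x ?H"
    unfolding infdist_notempty[OF \<open>?H \<noteq> {}\<close>] by (intro cINF_greatest) auto
  then have "a \<bullet> x - \<beta> \<le> norm a * infdist x ?H"
    using a0 by (simp add: field_simps)
  with upper False show ?thesis by simp
qed

section \<open>Nearest points in the \<open>p\<close>-norm\<close>

lemma pnorm_le_iff:
  assumes "p > 0"
  shows "pnorm p v \<le> pnorm p w \<longleftrightarrow>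
    (\<Sum>i\<in>UNIV. \<bar>v $ i\<bar> powr p) \<le> (\<Sum>i\<in>UNIV. \<bar>w $ i\<bar> powr p)"
proof -
  have mono: "s powr (1 / p) \<le> t powr (1 / p) \<longleftrightarrow> s \<le> t" if "0 \<le> s" "0 \<le> t" for s t :: real
    using that assms powr_mono2[of "1 / p" s t] powr_less_mono2[of "1 / p" t s]
    by (cases "s \<le> t") auto
  show ?thesis unfolding pnorm_def by (intro mono sum_nonneg powr_ge_zero)
qed

lemma abs_nth_le_pnorm:
  assumes "p > 0"
  shows "\<bar>v $ i\<bar> \<le> pnorm p v"
proof -
  have "\<bar>v $ i\<bar> = (\<bar>v $ i\<bar> powr p) powr (1 / p)"
    using assms by (simp add: powr_powr)
  also have "\<dots> \<le> pnorm p v" unfolding pnorm_def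
    using assms by (intro powr_mono2 member_le_sum) auto
  finally show ?thesis .
qed

lemma continuous_on_pnorm:
  assumes "p > 0" and "continuous_on S f"
  shows "continuous_on S (\<lambda>x. pnorm p (f x))"
  unfolding pnorm_def using assms
  by (intro continuous_on_powr' continuous_intros) (auto intro: sum_nonneg)

text \<open>Since the \<open>p\<close>-norm dominates every coordinate, its sublevel sets are bounded, and a
minimum over a closed set is a minimum over a compact part of it.\<close>

lemma closed_attains_pnorm_dist:
  fixes T :: "(real^'m::finite) set"
  assumes p: "p > 0" and T: "closed T" "T \<noteq> {}"
  obtains c where "c \<in> T" "\<And>c'. c' \<in> T \<Longrightarrow> pnorm p (b - c) \<le> pnorm p (b - c')"
proof -
  obtain c0 where c0: "c0 \<in> T" using T by blast
  define r where "r = pnorm p (b - c0)"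
  let ?K = "T \<inter> {c. pnorm p (b - c) \<le> r}"
  have cont: "continuous_on S (\<lambda>c. pnorm p (b - c))" for S
    by (intro continuous_on_pnorm p continuous_intros)
  have "closed {c. pnorm p (b - c) \<le> r}"
    using cont by (intro closed_Collect_le continuous_intros)
  then have "closed ?K" using T by blast
  moreover have "bounded ?K"
  proof -
    have "\<bar>c $ i\<bar> \<le> norm b + r" if "c \<in> ?K" for c i
      using that abs_nth_le_pnorm[OF p, of "b - c" i] component_le_norm_cart[of b i] by auto
    then have "norm c \<le> (\<Sum>i\<in>(UNIV :: 'm set). norm b + r)" if "c \<in> ?K" for c
      using that by (intro order_trans[OF norm_le_l1_cart] sum_mono) auto
    then show ?thesis by (rule boundedI)
  qed
  ultimately have "compact ?K" by (simp add: compact_eq_bounded_closed)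
  moreover have "c0 \<in> ?K" using c0 by (simp add: r_def)
  ultimately obtain c where c: "c \<in> ?K" "\<And>c'. c' \<in> ?K \<Longrightarrow> pnorm p (b - c) \<le> pnorm p (b - c')"
    using continuous_attains_inf[OF _ _ cont, of ?K] by blast
  show thesis
  proof
    show "c \<in> T" using c by blast
    show "pnorm p (b - c) \<le> pnorm p (b - c')" if "c' \<in> T" for c'
      using c that by (cases "c' \<in> ?K") auto
  qed
qed

section \<open>The cone of consistent right-hand sides\<close>

lemma convex_cone_sum:
  assumes "convex_cone S" and "\<And>i. i \<in> I \<Longrightarrow> f i \<in> S"
  shows "sum f I \<in> S"
  using assms(2)
  by (induction I rule: infinite_finite_induct)
    (auto simp: convex_cone_contains_0 convex_cone_add assms(1))

text \<open>A right-hand side is consistent exactly if it is \<open>A x + s\<close> with \<open>A\<close> the matrix with rows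
\<open>a i\<close>, any \<open>x\<close>, and \<open>s \<ge> 0\<close>. So the consistent right-hand sides are the cone generated
by the columns of \<open>A\<close>, their negatives and the unit vectors, and finitely generated cones are
closed.\<close>

lemma closed_consistent_rhs:
  fixes a :: "'m::finite \<Rightarrow> real^'n"
  shows "closed (consistent_rhs a)"
proof -
  define A :: "real^'n \<Rightarrow> real^'m" where "A x = (\<chi> i. a i \<bullet> x)" for x
  define G where "G = range (\<lambda>j. A (axis j 1)) \<union> range (\<lambda>j. - A (axis j 1))
    \<union> range (\<lambda>i. axis i 1)"
  let ?C = "convex_cone hull G"
  have C: "convex_cone ?C" by (rule convex_cone_convex_cone_hull)
  have "convex_cone (consistent_rhs a)"
  proof (unfold convex_cone_iff, intro conjI ballI allI impI)
    show "0 \<in> consistent_rhs a"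
      by (auto simp: consistent_rhs_def consistent_def intro: exI[of _ 0])
  next
    fix c d assume "c \<in> consistent_rhs a" "d \<in> consistent_rhs a"
    then obtain x y where "\<forall>i. a i \<bullet> x \<le> c $ i" "\<forall>i. a i \<bullet> y \<le> d $ i"
      by (auto simp: consistent_rhs_def consistent_def)
    then show "c + d \<in> consistent_rhs a"
      by (auto simp: consistent_rhs_def consistent_def inner_add_right
          intro!: exI[of _ "x + y"] add_mono)
  next
    fix c and t :: real assume "c \<in> consistent_rhs a" "t \<ge> 0"
    then obtain x where "\<forall>i. a i \<bullet> x \<le> c $ i"
      by (auto simp: consistent_rhs_def consistent_def)
    with \<open>t \<ge> 0\<close> show "t *\<^sub>R c \<in> consistent_rhs a"
      by (auto simp: consistent_rhs_def consistent_def
          intro!: exI[of _ "t *\<^sub>R x"] mult_left_mono)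
  qed
  moreover have "G \<subseteq> consistent_rhs a"
  proof -
    have "A x \<in> consistent_rhs a" for x
      by (auto simp: A_def consistent_rhs_def consistent_def)
    moreover have "- A x = A (- x)" for x by (simp add: A_def vec_eq_iff)
    moreover have "axis i 1 \<in> consistent_rhs a" for i
      by (auto simp: consistent_rhs_def consistent_def axis_def intro!: exI[of _ 0])
    ultimately show ?thesis unfolding G_def by auto
  qed
  ultimately have sub: "?C \<subseteq> consistent_rhs a" by (simp add: hull_minimal)
  have "c \<in> ?C" if c: "c \<in> consistent_rhs a" for c
  proof -
    obtain x where x: "\<forall>i. a i \<bullet> x \<le> c $ i"
      using c by (auto simp: consistent_rhs_def consistent_def)
    have gen: "t *\<^sub>R g \<in> ?C" if "g \<in> G" "t \<ge> 0" for g t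
      using that by (simp add: convex_cone_hull_mul hull_inc)
    \<comment> \<open>Coefficients in a cone are nonnegative, so the sign of \<open>x $ j\<close> decides whether the
      column or its negative is used.\<close>
    have "x $ j *\<^sub>R A (axis j 1) \<in> ?C" for j
    proof (cases "x $ j \<ge> 0")
      case True
      then show ?thesis by (intro gen) (auto simp: G_def)
    next
      case False
      then have "(- x $ j) *\<^sub>R (- A (axis j 1)) \<in> ?C" by (intro gen) (auto simp: G_def)
      then show ?thesis by simp
    qed
    then have "(\<Sum>j\<in>UNIV. x $ j *\<^sub>R A (axis j 1)) \<in> ?C"
      by (intro convex_cone_sum C)
    moreover have "(\<Sum>j\<in>UNIV. x $ j *\<^sub>R A (axis j 1)) = A x"
      by (simp add: A_def vec_eq_iff inner_vec_def[of "a _" x] inner_axis mult.commute)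
    moreover have "(\<Sum>i\<in>UNIV. (c $ i - a i \<bullet> x) *\<^sub>R axis i (1::real)) \<in> ?C"
      using x by (intro convex_cone_sum C gen) (auto simp: G_def)
    moreover have "(\<Sum>i\<in>UNIV. (c $ i - a i \<bullet> x) *\<^sub>R axis i (1::real)) = c - A x"
      by (simp add: A_def vec_eq_iff axis_def if_distrib cong: if_cong)
    ultimately show "c \<in> ?C"
      using convex_cone_hull_add[of "A x" G "c - A x"] by simp
  qed
  with sub have "consistent_rhs a = ?C" by blast
  moreover have "finite G" by (simp add: G_def)
  ultimately show ?thesis by (simp add: closed_convex_cone_hull)
qed

section \<open>The excess vector\<close>

definition excess :: "('m::finite \<Rightarrow> real^'n) \<Rightarrow> real^'m \<Rightarrow> real^'n \<Rightarrow> real^'m" where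
  "excess a b x = (\<chi> i. max (a i \<bullet> x - b $ i) 0)"

lemma add_excess_consistent: "b + excess a b x \<in> consistent_rhs a"
  by (auto simp: consistent_rhs_def consistent_def excess_def intro!: exI[of _ x])

lemma pnorm_excess_le:
  assumes "p > 0" and "\<And>i. a i \<bullet> x \<le> c $ i"
  shows "pnorm p (excess a b x) \<le> pnorm p (b - c)"
  unfolding pnorm_le_iff[OF assms(1)]
proof (intro sum_mono powr_mono2)
  fix i
  show "\<bar>excess a b x $ i\<bar> \<le> \<bar>(b - c) $ i\<bar>"
    using assms(2)[of i] by (auto simp: excess_def)
qed (use assms(1) in simp_all)

lemma minimal_excess_unique:
  assumes p: "p > 1"
    and x: "\<And>z. pnorm p (excess a b x) \<le> pnorm p (excess a b z)"
    and y: "\<And>z. pnorm p (excess a b y) \<le> pnorm p (excess a b z)"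
  shows "excess a b x = excess a b y"
proof (rule ccontr)
  assume "excess a b x \<noteq> excess a b y"
  then obtain k where k: "excess a b x $ k \<noteq> excess a b y $ k" by (auto simp: vec_eq_iff)
  define E where "E z i = excess a b z $ i" for z i
  define F where "F z = (\<Sum>i\<in>UNIV. \<bar>E z i\<bar> powr p)" for z
  have nonneg: "0 \<le> E z i" for z i by (simp add: E_def excess_def)
  have le: "F x \<le> F z" "F y \<le> F z" for z
    using x[of z] y[of z] p by (simp_all add: pnorm_le_iff F_def E_def)
  define m where "m = (1/2) *\<^sub>R (x + y)"
  have mean: "E m i \<le> (E x i + E y i) / 2" for i
    by (auto simp: E_def excess_def m_def inner_add_right max_def field_simps)
  have le_half: "E m i powr p \<le> ((E x i + E y i) / 2) powr p" for i
    using p by (intro powr_mono2 mean nonneg) auto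
  have strict: "E m i powr p < (E x i powr p + E y i powr p) / 2" if "E x i \<noteq> E y i" for i
    using le_less_trans[OF le_half powr_midpoint_strict[OF p nonneg nonneg that]] .
  \<comment> \<open>The strict estimate covers the coordinates on which the excesses differ, and on the others the
    mean is the common value.\<close>
  have weak: "E m i powr p \<le> (E x i powr p + E y i powr p) / 2" for i
    using strict[of i] le_half[of i] by (cases "E x i = E y i") auto
  have "F m < (\<Sum>i\<in>UNIV. (E x i powr p + E y i powr p) / 2)"
    unfolding F_def using strict[of k] k weak nonneg
    by (intro sum_strict_mono_ex1) (auto simp: E_def)
  also have "\<dots> = (F x + F y) / 2"
    using nonneg by (simp add: F_def sum.distrib flip: sum_divide_distrib)
  finally show False using le[of m] by simp
qed

text \<open>The witness is a solution \<open>x\<close> of the system at a right-hand side \<open>c\<close> nearest to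
\<open>b\<close>: its excess costs no more than \<open>b - c\<close>, while the excess at any \<open>z\<close> leads to a
consistent right-hand side and so costs at least as much as \<open>b - c\<close>.\<close>

lemma minimal_excess_exists:
  fixes a :: "'m::finite \<Rightarrow> real^'n"
  assumes p: "p > 0"
  obtains x where "\<And>z. pnorm p (excess a b x) \<le> pnorm p (excess a b z)"
proof -
  have "consistent_rhs a \<noteq> {}" using add_excess_consistent by blast
  then obtain c where c: "c \<in> consistent_rhs a"
      "\<And>c'. c' \<in> consistent_rhs a \<Longrightarrow> pnorm p (b - c) \<le> pnorm p (b - c')"
    using closed_attains_pnorm_dist[OF p closed_consistent_rhs] by metis
  then obtain x where x: "\<forall>i. a i \<bullet> x \<le> c $ i"
    by (auto simp: consistent_rhs_def consistent_def)
  show thesis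
  proof
    fix z
    have "pnorm p (excess a b x) \<le> pnorm p (b - c)"
      using x by (intro pnorm_excess_le p) blast
    also have "\<dots> \<le> pnorm p (b - (b + excess a b z))"
      by (rule c(2)[OF add_excess_consistent])
    also have "\<dots> = pnorm p (excess a b z)" by (simp add: pnorm_def)
    finally show "pnorm p (excess a b x) \<le> pnorm p (excess a b z)" .
  qed
qed

lemma pdist_set_eq_minimal_excess:
  assumes p: "p > 0" and x: "\<And>z. pnorm p (excess a b x) \<le> pnorm p (excess a b z)"
  shows "pdist_set p b (consistent_rhs a) = pnorm p (excess a b x)"
  unfolding pdist_set_def
proof (rule cInf_eq_minimum)
  have "pnorm p (excess a b x) = pnorm p (b - (b + excess a b x))" by (simp add: pnorm_def)
  then show "pnorm p (excess a b x) \<in> (\<lambda>b'. pnorm p (b - b')) ` consistent_rhs a"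
    by (rule image_eqI) (rule add_excess_consistent)
next
  fix t assume "t \<in> (\<lambda>b'. pnorm p (b - b')) ` consistent_rhs a"
  then obtain c z where c: "t = pnorm p (b - c)" "\<forall>i. a i \<bullet> z \<le> c $ i"
    by (auto simp: consistent_rhs_def consistent_def)
  then show "pnorm p (excess a b x) \<le> t"
    using x[of z] pnorm_excess_le[OF p, of a z c b] by simp
qed

text \<open>The distance formula turns the objective into the \<open>p\<close>-th power of the \<open>p\<close>-norm of the
excess, and taking the \<open>p\<close>-th root is increasing. The formula enters as a hypothesis because
it is false for an empty halfspace, where \<open>infdist\<close> is \<open>0\<close> by convention.\<close>

lemma minimizers_eq:
  assumes p: "p > 0"
    and dist: "\<And>x i. norm (a i) * infdist x (halfspace a b i) = excess a b x $ i"
  shows "minimizers p a b = {x. \<forall>z. pnorm p (excess a b x) \<le> pnorm p (excess a b z)}"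
proof -
  have "norm (a i) powr p * infdist x (halfspace a b i) powr p = \<bar>excess a b x $ i\<bar> powr p" for x i
  proof -
    have "norm (a i) powr p * infdist x (halfspace a b i) powr p = (excess a b x $ i) powr p"
      unfolding dist[symmetric] by (rule powr_mult[symmetric])
    also have "excess a b x $ i = \<bar>excess a b x $ i\<bar>" by (simp add: excess_def)
    finally show ?thesis .
  qed
  then show ?thesis
    by (simp add: minimizers_def is_arg_min_linorder pnorm_le_iff[OF p])
qed

section \<open>The nearest consistent system\<close>

theorem corollary28:
  fixes a :: "'m::finite \<Rightarrow> real^'n" and b :: "real^'m" and p :: real
  assumes "p \<ge> 2"
    and "\<not> consistent a b"
    and "\<And>i. \<exists>x. a i \<bullet> x < b $ i"
  shows "minimizers p a b \<noteq> {}
    \<and> pdist_set p b (consistent_rhs a) = pnorm p (residual p a b)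
    \<and> (\<forall>x \<in> minimizers p a b. \<forall>i.
          residual p a b $ i = norm (a i) * infdist x (halfspace a b i)
        \<and> norm (a i) * infdist x (halfspace a b i) = max (a i \<bullet> x - b $ i) 0)
    \<and> b + residual p a b \<in> consistent_rhs a
    \<and> pnorm p (residual p a b) = pdist_set p b (consistent_rhs a)"
proof -
  have p: "p > 0" "p > 1" using assms(1) by auto
  have dist: "norm (a i) * infdist x (halfspace a b i) = excess a b x $ i" for x i
    using assms(3)[of i] norm_mult_infdist_halfspace[of "a i" _ "b $ i" x]
    by (auto simp: halfspace_def excess_def intro: less_imp_le)
  note minimizers = minimizers_eq[OF p(1) dist]
  obtain x0 where x0: "\<And>z. pnorm p (excess a b x0) \<le> pnorm p (excess a b z)"
    using minimal_excess_exists[OF p(1)] by metis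
  then have mem: "x0 \<in> minimizers p a b" by (simp add: minimizers)
  have same: "excess a b x = excess a b x0" if "x \<in> minimizers p a b" for x
    using that x0 by (intro minimal_excess_unique[OF p(2)]) (auto simp: minimizers)
  have res: "residual p a b = excess a b x0"
  proof -
    have "(\<lambda>x. excess a b x $ i) ` minimizers p a b = (\<lambda>x. excess a b x0 $ i) ` minimizers p a b"
      for i by (rule image_cong[OF refl]) (simp only: same)
    then have "(\<lambda>x. norm (a i) * infdist x (halfspace a b i)) ` minimizers p a b
        = {excess a b x0 $ i}" for i
      using mem by (auto simp: dist)
    then show ?thesis by (simp add: residual_def vec_eq_iff)
  qed
  have "pdist_set p b (consistent_rhs a) = pnorm p (residual p a b)"
    by (simp add: res pdist_set_eq_minimal_excess[OF p(1) x0])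
  moreover have "residual p a b $ i = norm (a i) * infdist x (halfspace a b i)
      \<and> norm (a i) * infdist x (halfspace a b i) = max (a i \<bullet> x - b $ i) 0"
    if "x \<in> minimizers p a b" for x i
    unfolding res dist same[OF that, symmetric] by (simp add: excess_def)
  moreover have "b + residual p a b \<in> consistent_rhs a"
    by (simp add: res add_excess_consistent)
  ultimately show ?thesis using mem by auto
qed

end
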